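(* Let $S$ be a (not necessarily commutative) ring containing a regular commutative ring $R$ as a subring. Assume that $S$, considered as a right $R$-module, is projective. Let $E$ be a left $S$-module which is injective as a left $S$-module. Then $E$, regarded as an $R$-module by restriction of scalars along $R \subseteq S$, is an injective $R$-module.
   Context: Rings are associative with identity, and a subring shares the identity. A regular commutative ring is a commutative Noetherian ring $R$ such that $R_P$ is a regular local ring for every prime ideal $P$ of $R$. The ring $R$ is not assumed to be central in $S$. *)

theory Defs
  imports "HOL-Algebra.Algebra" "HOL-Library.Extended_Nat"
begin

section \<open>Localization of a commutative ring\<close>

definition fraction_rel :: "('a, 'k) ring_scheme \<Rightarrow> 'a set \<Rightarrow> (('a \<times> 'a) \<times> ('a \<times> 'a)) set"
  where "fraction_rel R T =
    {((a, s), (b, t)). a \<in> carrier R \<and> s \<in> T \<and> b \<in> carrier R \<and> t \<in> T \<and>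
       (\<exists>u\<in>T. u \<otimes>\<^bsub>R\<^esub> (a \<otimes>\<^bsub>R\<^esub> t \<ominus>\<^bsub>R\<^esub> b \<otimes>\<^bsub>R\<^esub> s) = \<zero>\<^bsub>R\<^esub>)}"

definition fraction :: "('a, 'k) ring_scheme \<Rightarrow> 'a set \<Rightarrow> 'a \<Rightarrow> 'a \<Rightarrow> ('a \<times> 'a) set"
  where "fraction R T a s = fraction_rel R T `` {(a, s)}"

definition localization :: "('a, 'k) ring_scheme \<Rightarrow> 'a set \<Rightarrow> ('a \<times> 'a) set ring"
  where "localization R T =
    \<lparr>carrier = (carrier R \<times> T) // fraction_rel R T,
     monoid.mult = (\<lambda>A B. \<Union>(a, s)\<in>A. \<Union>(b, t)\<in>B. fraction R T (a \<otimes>\<^bsub>R\<^esub> b) (s \<otimes>\<^bsub>R\<^esub> t)),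
     monoid.one = fraction R T \<one>\<^bsub>R\<^esub> \<one>\<^bsub>R\<^esub>,
     ring.zero = fraction R T \<zero>\<^bsub>R\<^esub> \<one>\<^bsub>R\<^esub>,
     ring.add = (\<lambda>A B. \<Union>(a, s)\<in>A. \<Union>(b, t)\<in>B.
              fraction R T (a \<otimes>\<^bsub>R\<^esub> t \<oplus>\<^bsub>R\<^esub> b \<otimes>\<^bsub>R\<^esub> s) (s \<otimes>\<^bsub>R\<^esub> t))\<rparr>"

definition localization_at_prime :: "('a, 'k) ring_scheme \<Rightarrow> 'a set \<Rightarrow> ('a \<times> 'a) set ring"
  where "localization_at_prime R P = localization R (carrier R - P)"

section \<open>Regular rings\<close>

definition krull_dim :: "('a, 'k) ring_scheme \<Rightarrow> enat"
  where "krull_dim R = Sup {enat n | n. \<exists>P :: nat \<Rightarrow> 'a set.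
    (\<forall>i\<le>n. primeideal (P i) R) \<and> (\<forall>i<n. P i \<subset> P (Suc i))}"

definition min_generators :: "('a, 'k) ring_scheme \<Rightarrow> 'a set \<Rightarrow> nat"
  where "min_generators R I =
    (LEAST n. \<exists>A\<subseteq>carrier R. finite A \<and> card A = n \<and> Idl\<^bsub>R\<^esub> A = I)"

locale local_ring = cring +
  assumes unique_maximal: "\<exists>!M. maximalideal M R"

locale regular_local_ring = local_ring + noetherian_ring +
  assumes regular: "maximalideal M R \<Longrightarrow> enat (min_generators R M) = krull_dim R"

locale regular_ring = cring + noetherian_ring +
  assumes regular_at_prime: "primeideal P R \<Longrightarrow> regular_local_ring (localization_at_prime R P)"

section \<open>Modules over a not necessarily commutative ring\<close>

locale left_module = R?: ring R + M?: abelian_group M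
  for R :: "('r, 'k) ring_scheme" (structure) and M :: "('r, 'm, 'c) module_scheme" (structure) +
  assumes smult_closed:
      "\<lbrakk>a \<in> carrier R; x \<in> carrier M\<rbrakk> \<Longrightarrow> a \<odot>\<^bsub>M\<^esub> x \<in> carrier M"
    and smult_l_distr:
      "\<lbrakk>a \<in> carrier R; b \<in> carrier R; x \<in> carrier M\<rbrakk> \<Longrightarrow>
       (a \<oplus> b) \<odot>\<^bsub>M\<^esub> x = a \<odot>\<^bsub>M\<^esub> x \<oplus>\<^bsub>M\<^esub> b \<odot>\<^bsub>M\<^esub> x"
    and smult_r_distr:
      "\<lbrakk>a \<in> carrier R; x \<in> carrier M; y \<in> carrier M\<rbrakk> \<Longrightarrow>
       a \<odot>\<^bsub>M\<^esub> (x \<oplus>\<^bsub>M\<^esub> y) = a \<odot>\<^bsub>M\<^esub> x \<oplus>\<^bsub>M\<^esub> a \<odot>\<^bsub>M\<^esub> y"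
    and smult_assoc1:
      "\<lbrakk>a \<in> carrier R; b \<in> carrier R; x \<in> carrier M\<rbrakk> \<Longrightarrow>
       (a \<otimes> b) \<odot>\<^bsub>M\<^esub> x = a \<odot>\<^bsub>M\<^esub> (b \<odot>\<^bsub>M\<^esub> x)"
    and smult_one: "x \<in> carrier M \<Longrightarrow> \<one> \<odot>\<^bsub>M\<^esub> x = x"

text \<open>Right modules use the same record type; the field \<open>smult\<close> then holds the right action,
  \<open>smult M a x\<close> standing for \<open>x \<cdot> a\<close>. Only the associativity law differs from that of
  left modules.\<close>

locale right_module = R?: ring R + M?: abelian_group M
  for R :: "('r, 'k) ring_scheme" (structure) and M :: "('r, 'm, 'c) module_scheme" (structure) +
  assumes smult_closed:
      "\<lbrakk>a \<in> carrier R; x \<in> carrier M\<rbrakk> \<Longrightarrow> a \<odot>\<^bsub>M\<^esub> x \<in> carrier M"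
    and smult_l_distr:
      "\<lbrakk>a \<in> carrier R; b \<in> carrier R; x \<in> carrier M\<rbrakk> \<Longrightarrow>
       (a \<oplus> b) \<odot>\<^bsub>M\<^esub> x = a \<odot>\<^bsub>M\<^esub> x \<oplus>\<^bsub>M\<^esub> b \<odot>\<^bsub>M\<^esub> x"
    and smult_r_distr:
      "\<lbrakk>a \<in> carrier R; x \<in> carrier M; y \<in> carrier M\<rbrakk> \<Longrightarrow>
       a \<odot>\<^bsub>M\<^esub> (x \<oplus>\<^bsub>M\<^esub> y) = a \<odot>\<^bsub>M\<^esub> x \<oplus>\<^bsub>M\<^esub> a \<odot>\<^bsub>M\<^esub> y"
    and smult_assoc1:
      "\<lbrakk>a \<in> carrier R; b \<in> carrier R; x \<in> carrier M\<rbrakk> \<Longrightarrow>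
       (a \<otimes> b) \<odot>\<^bsub>M\<^esub> x = b \<odot>\<^bsub>M\<^esub> (a \<odot>\<^bsub>M\<^esub> x)"
    and smult_one: "x \<in> carrier M \<Longrightarrow> \<one> \<odot>\<^bsub>M\<^esub> x = x"

definition linear_maps ::
    "('r, 'k) ring_scheme \<Rightarrow> ('r, 'm, 'c) module_scheme \<Rightarrow> ('r, 'n, 'd) module_scheme \<Rightarrow> ('m \<Rightarrow> 'n) set"
  where "linear_maps R M N =
    {h. h \<in> carrier M \<rightarrow> carrier N \<and>
        (\<forall>x\<in>carrier M. \<forall>y\<in>carrier M. h (x \<oplus>\<^bsub>M\<^esub> y) = h x \<oplus>\<^bsub>N\<^esub> h y) \<and>
        (\<forall>a\<in>carrier R. \<forall>x\<in>carrier M. h (a \<odot>\<^bsub>M\<^esub> x) = a \<odot>\<^bsub>N\<^esub> h x)}"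

definition right_module_of_ring :: "('a, 'k) ring_scheme \<Rightarrow> ('a, 'a) module"
  where "right_module_of_ring S =
    \<lparr>carrier = carrier S, monoid.mult = monoid.mult S,
     monoid.one = monoid.one S, ring.zero = ring.zero S, ring.add = ring.add S,
     smult = (\<lambda>a x. x \<otimes>\<^bsub>S\<^esub> a)\<rparr>"

text \<open>HOL cannot quantify over types inside a formula, so the element types \<open>'m\<close> and \<open>'n\<close> of the
  test modules are parameters. Injectivity over \<open>R\<close> in the usual sense is the conjunction over all
  \<open>'m\<close>, \<open>'n\<close>; by Baer's criterion it is already implied by the instance in which both are
  the element type of \<open>R\<close>, since that instance covers the inclusions of left ideals into \<open>R\<close>.\<close>

definition injective_left_module ::
    "'m itself \<Rightarrow> 'n itself \<Rightarrow> ('r, 'k) ring_scheme \<Rightarrow> ('r, 'e, 'c) module_scheme \<Rightarrow> bool"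
  where "injective_left_module _ _ R E \<longleftrightarrow>
    left_module R E \<and>
    (\<forall>(M :: ('r, 'm) module) (N :: ('r, 'n) module). \<forall>i\<in>linear_maps R M N. \<forall>g\<in>linear_maps R M E.
       left_module R M \<longrightarrow> left_module R N \<longrightarrow> inj_on i (carrier M) \<longrightarrow>
       (\<exists>h\<in>linear_maps R N E. \<forall>x\<in>carrier M. h (i x) = g x))"

text \<open>Here \<open>'m\<close> and \<open>'n\<close> are the element types of the source and target of the test epimorphism.
  For \<open>P\<close> with elements of type \<open>'p\<close>, over \<open>R\<close> with elements of type \<open>'r\<close>, projectivity in the
  usual sense is implied by the instance \<open>'m = ('p \<Rightarrow> 'r)\<close>, \<open>'n = 'p\<close>, since that instance covers the
  canonical epimorphism onto \<open>P\<close> from the free module of finitely supported functions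
  \<open>P \<rightarrow> R\<close>.\<close>

definition projective_right_module ::
    "'m itself \<Rightarrow> 'n itself \<Rightarrow> ('r, 'k) ring_scheme \<Rightarrow> ('r, 'p, 'c) module_scheme \<Rightarrow> bool"
  where "projective_right_module _ _ R P \<longleftrightarrow>
    right_module R P \<and>
    (\<forall>(M :: ('r, 'm) module) (N :: ('r, 'n) module). \<forall>q\<in>linear_maps R M N. \<forall>g\<in>linear_maps R P N.
       right_module R M \<longrightarrow> right_module R N \<longrightarrow> q ` carrier M = carrier N \<longrightarrow>
       (\<exists>h\<in>linear_maps R P M. \<forall>x\<in>carrier P. q (h x) = g x))"

end

theory Submission
  imports Defs
begin

text \<open>
  By Baer's criterion it suffices to extend an \<open>R\<close>-linear map \<open>g : I \<rightarrow> E\<close> from an ideal \<open>I\<close> of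
  \<open>R\<close> to \<open>R\<close>. Projectivity of \<open>S\<close> gives a dual basis: right linear maps \<open>h\<^sub>k : S \<rightarrow> R\<close>, indexed by
  \<open>k \<in> S\<close>, with \<open>x = \<Sum>\<^sub>k k h\<^sub>k(x)\<close> as a finite sum for every \<open>x\<close>. The coordinates of an element of
  \<open>S I\<close> lie in \<open>I\<close>, so \<open>f(x) = \<Sum>\<^sub>k k g(h\<^sub>k(x))\<close> is a map \<open>S I \<rightarrow> E\<close>. It satisfies
  \<open>f(s a) = s g(a)\<close>, hence is \<open>S\<close>-linear and extends \<open>g\<close>; by injectivity over \<open>S\<close> it is
  \<open>x \<mapsto> x e\<close> for some \<open>e \<in> E\<close>, and so is \<open>g\<close>. This concrete \<open>f\<close> replaces the
  isomorphism \<open>S \<otimes>\<^sub>R I \<cong> S I\<close> given by flatness.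
\<close>

section \<open>Left ideals and Baer's criterion\<close>

context left_module
begin

lemma smult_zero_left: "x \<in> carrier M \<Longrightarrow> \<zero> \<odot>\<^bsub>M\<^esub> x = \<zero>\<^bsub>M\<^esub>"
  using smult_l_distr[of \<zero> \<zero> x] smult_closed[of \<zero> x] M.add.l_cancel_one by fastforce

lemma smult_zero_right: "a \<in> carrier R \<Longrightarrow> a \<odot>\<^bsub>M\<^esub> \<zero>\<^bsub>M\<^esub> = \<zero>\<^bsub>M\<^esub>"
  using smult_r_distr[of a "\<zero>\<^bsub>M\<^esub>" "\<zero>\<^bsub>M\<^esub>"] smult_closed[of a "\<zero>\<^bsub>M\<^esub>"] M.add.l_cancel_one by fastforce

lemma smult_minus_one: "x \<in> carrier M \<Longrightarrow> (\<ominus> \<one>) \<odot>\<^bsub>M\<^esub> x = \<ominus>\<^bsub>M\<^esub> x"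
  using smult_l_distr[of "\<ominus> \<one>" \<one> x] smult_one[of x] smult_closed[of "\<ominus> \<one>" x]
  by (simp add: R.l_neg smult_zero_left M.minus_equality)

text \<open>Additivity in the scalar is applied summand by summand. For infinite \<open>A\<close>
  both sums default to zero, so that case rests on \<open>smult_zero_left\<close>.\<close>

lemma finsum_smult:
  assumes "f \<in> A \<rightarrow> carrier R" "x \<in> carrier M"
  shows "(\<Oplus>k\<in>A. f k) \<odot>\<^bsub>M\<^esub> x = (\<Oplus>\<^bsub>M\<^esub>k\<in>A. f k \<odot>\<^bsub>M\<^esub> x)"
  using assms(1)
proof (induction A rule: infinite_finite_induct)
  case (insert k A)
  then show ?case
    using assms(2)
    by (subst R.finsum_insert, simp, simp, simp, simp)
       (subst M.finsum_insert, auto simp: smult_l_distr smult_closed Pi_iff)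
qed (use assms(2) in \<open>auto simp: smult_zero_left\<close>)

end

text \<open>One-sided ideals are the right setting because \<open>S I\<close> is in general only a
  left ideal of \<open>S\<close>. Closure under negation follows, via multiplication by
  \<open>-1\<close>.\<close>

definition left_ideal :: "('a, 'k) ring_scheme \<Rightarrow> 'a set \<Rightarrow> bool"
  where "left_ideal R I \<longleftrightarrow> I \<subseteq> carrier R \<and> \<zero>\<^bsub>R\<^esub> \<in> I \<and>
    (\<forall>a\<in>I. \<forall>b\<in>I. a \<oplus>\<^bsub>R\<^esub> b \<in> I) \<and> (\<forall>r\<in>carrier R. \<forall>a\<in>I. r \<otimes>\<^bsub>R\<^esub> a \<in> I)"

text \<open>The elements keep the type of the ring, so that left ideals of \<open>S\<close> and
  \<open>S\<close> itself both fall under the test modules with elements of type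
  \<open>'s\<close>.\<close>

definition ideal_module :: "('a, 'k) ring_scheme \<Rightarrow> 'a set \<Rightarrow> ('a, 'a) module"
  where "ideal_module R I =
    \<lparr>carrier = I, monoid.mult = monoid.mult R, monoid.one = monoid.one R,
     ring.zero = ring.zero R, ring.add = ring.add R, smult = monoid.mult R\<rparr>"

lemma ideal_module_simps [simp]:
  "carrier (ideal_module R I) = I" "\<zero>\<^bsub>ideal_module R I\<^esub> = \<zero>\<^bsub>R\<^esub>"
  "x \<oplus>\<^bsub>ideal_module R I\<^esub> y = x \<oplus>\<^bsub>R\<^esub> y" "a \<odot>\<^bsub>ideal_module R I\<^esub> x = a \<otimes>\<^bsub>R\<^esub> x"
  by (simp_all add: ideal_module_def)

lemma left_module_ideal_module:
  assumes "ring R" "left_ideal R I"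
  shows "left_module R (ideal_module R I)"
proof -
  interpret ring R by fact
  have sub: "I \<subseteq> carrier R" and I: "\<zero>\<^bsub>R\<^esub> \<in> I" "\<And>a b. a \<in> I \<Longrightarrow> b \<in> I \<Longrightarrow> a \<oplus>\<^bsub>R\<^esub> b \<in> I"
    "\<And>r a. r \<in> carrier R \<Longrightarrow> a \<in> I \<Longrightarrow> r \<otimes>\<^bsub>R\<^esub> a \<in> I"
    using assms(2) unfolding left_ideal_def by auto
  \<comment> \<open>The inverse of \<open>x\<close> is \<open>(-1) x\<close>, which lies in
    \<open>I\<close> because \<open>I\<close> absorbs multiplication from the left.\<close>
  have neg: "\<exists>y\<in>I. y \<oplus>\<^bsub>R\<^esub> x = \<zero>\<^bsub>R\<^esub>" if "x \<in> I" for x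
  proof (rule bexI)
    show "\<ominus>\<^bsub>R\<^esub> \<one>\<^bsub>R\<^esub> \<otimes>\<^bsub>R\<^esub> x \<in> I" using I(3)[of "\<ominus>\<^bsub>R\<^esub> \<one>\<^bsub>R\<^esub>" x] that by simp
    show "\<ominus>\<^bsub>R\<^esub> \<one>\<^bsub>R\<^esub> \<otimes>\<^bsub>R\<^esub> x \<oplus>\<^bsub>R\<^esub> x = \<zero>\<^bsub>R\<^esub>"
      using that sub l_minus[of "\<one>\<^bsub>R\<^esub>" x] l_neg[of x] by auto
  qed
  have "abelian_group (ideal_module R I)"
    by (rule abelian_groupI) (use sub I neg in \<open>auto simp: a_ac subset_iff\<close>)
  then show ?thesis
    unfolding left_module_def left_module_axioms_def
    using sub I(3) assms(1) by (auto simp: subset_iff l_distr r_distr m_assoc)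
qed

text \<open>Extending \<open>f\<close> from \<open>I\<close> to the whole ring amounts to choosing
  \<open>e\<close>, the value at one. This form quantifies over no type of test modules, so it can
  pass from \<open>S\<close> to \<open>R\<close> and afterwards serve test modules of any
  type.\<close>

definition baer :: "('r, 'k) ring_scheme \<Rightarrow> ('r, 'e, 'c) module_scheme \<Rightarrow> bool"
  where "baer R E \<longleftrightarrow> (\<forall>I f. left_ideal R I \<longrightarrow> f \<in> linear_maps R (ideal_module R I) E \<longrightarrow>
    (\<exists>e\<in>carrier E. \<forall>a\<in>I. f a = a \<odot>\<^bsub>E\<^esub> e))"

section \<open>Partial linear maps given by their graphs\<close>

text \<open>The last clause makes a submodule of \<open>N \<times> E\<close> single-valued.\<close>

definition linear_graph ::
    "('r, 'k) ring_scheme \<Rightarrow> ('r, 'n, 'd) module_scheme \<Rightarrow> ('r, 'e, 'c) module_scheme \<Rightarrow> ('n \<times> 'e) set \<Rightarrow> bool"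
  where "linear_graph R N E K \<longleftrightarrow> K \<subseteq> carrier N \<times> carrier E \<and> (\<zero>\<^bsub>N\<^esub>, \<zero>\<^bsub>E\<^esub>) \<in> K \<and>
    (\<forall>u v u' v'. (u, v) \<in> K \<longrightarrow> (u', v') \<in> K \<longrightarrow> (u \<oplus>\<^bsub>N\<^esub> u', v \<oplus>\<^bsub>E\<^esub> v') \<in> K) \<and>
    (\<forall>r\<in>carrier R. \<forall>u v. (u, v) \<in> K \<longrightarrow> (r \<odot>\<^bsub>N\<^esub> u, r \<odot>\<^bsub>E\<^esub> v) \<in> K) \<and>
    (\<forall>v. (\<zero>\<^bsub>N\<^esub>, v) \<in> K \<longrightarrow> v = \<zero>\<^bsub>E\<^esub>)"

lemma linear_graphD:
  assumes "linear_graph R N E K"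
  shows "(u, v) \<in> K \<Longrightarrow> u \<in> carrier N" "(u, v) \<in> K \<Longrightarrow> v \<in> carrier E" "(\<zero>\<^bsub>N\<^esub>, \<zero>\<^bsub>E\<^esub>) \<in> K"
    "(u, v) \<in> K \<Longrightarrow> (u', v') \<in> K \<Longrightarrow> (u \<oplus>\<^bsub>N\<^esub> u', v \<oplus>\<^bsub>E\<^esub> v') \<in> K"
    "r \<in> carrier R \<Longrightarrow> (u, v) \<in> K \<Longrightarrow> (r \<odot>\<^bsub>N\<^esub> u, r \<odot>\<^bsub>E\<^esub> v) \<in> K"
    "(\<zero>\<^bsub>N\<^esub>, v) \<in> K \<Longrightarrow> v = \<zero>\<^bsub>E\<^esub>"
  using assms unfolding linear_graph_def by blast+

lemma linear_graph_minus:
  assumes "left_module R N" "left_module R E" "linear_graph R N E K" "(u, v) \<in> K"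
  shows "(\<ominus>\<^bsub>N\<^esub> u, \<ominus>\<^bsub>E\<^esub> v) \<in> K"
proof -
  interpret N: left_module R N by fact
  interpret E: left_module R E by fact
  show ?thesis
    using linear_graphD(5)[OF assms(3), of "\<ominus>\<^bsub>R\<^esub> \<one>\<^bsub>R\<^esub>"] linear_graphD(1,2)[OF assms(3,4)] assms(4)
    by (metis N.smult_minus_one E.smult_minus_one N.R.a_inv_closed N.R.one_closed)
qed

text \<open>Two pairs over \<open>u\<close> differ by a pair over zero, whose second component
  vanishes by the last clause of \<open>linear_graph\<close>.\<close>

lemma linear_graph_unique:
  assumes "left_module R N" "left_module R E" "linear_graph R N E K" "(u, v) \<in> K" "(u, v') \<in> K"
  shows "v = v'"
proof -
  interpret N: left_module R N by fact
  interpret E: left_module R E by fact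
  have "(u \<oplus>\<^bsub>N\<^esub> \<ominus>\<^bsub>N\<^esub> u, v \<oplus>\<^bsub>E\<^esub> \<ominus>\<^bsub>E\<^esub> v') \<in> K"
    using linear_graphD(4)[OF assms(3,4) linear_graph_minus[OF assms(1-3,5)]] .
  then have "v \<oplus>\<^bsub>E\<^esub> \<ominus>\<^bsub>E\<^esub> v' = \<zero>\<^bsub>E\<^esub>"
    using linear_graphD(1,6)[OF assms(3)] assms(4) by (metis N.M.r_neg)
  then show ?thesis
    using linear_graphD(2)[OF assms(3)] assms(4,5)
    by (metis E.M.minus_equality E.M.minus_minus E.M.a_inv_closed)
qed

text \<open>This is the one-step extension in Baer's argument. The scalars \<open>r\<close> with
  \<open>r y\<close> in the domain of \<open>K\<close> form a left ideal \<open>I\<close>, and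
  sending \<open>r\<close> to the value of \<open>K\<close> at \<open>r y\<close> is linear on
  \<open>I\<close>. Baer's condition represents this map by some \<open>e\<close>, and
  \<open>y\<close> is sent to \<open>e\<close>.\<close>

lemma linear_graph_extend:
  assumes N: "left_module R N" and E: "left_module R E" and "baer R E"
    and K: "linear_graph R N E K" and y: "y \<in> carrier N"
  obtains K' where "linear_graph R N E K'" "K \<subseteq> K'" "y \<in> fst ` K'"
proof -
  interpret N: left_module R N by fact
  interpret E: left_module R E by fact
  note D = linear_graphD[OF K]
  define I where "I = {r \<in> carrier R. \<exists>v. (r \<odot>\<^bsub>N\<^esub> y, v) \<in> K}"
  define f where "f r = (THE v. (r \<odot>\<^bsub>N\<^esub> y, v) \<in> K)" for r
  have fI: "f r = v" if "(r \<odot>\<^bsub>N\<^esub> y, v) \<in> K" for r v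
    unfolding f_def using that linear_graph_unique[OF N E K] by blast
  have mem: "(r \<odot>\<^bsub>N\<^esub> y, f r) \<in> K" "r \<in> carrier R" if "r \<in> I" for r
    using that fI unfolding I_def by auto
  have add: "((a \<oplus>\<^bsub>R\<^esub> b) \<odot>\<^bsub>N\<^esub> y, f a \<oplus>\<^bsub>E\<^esub> f b) \<in> K" if "a \<in> I" "b \<in> I" for a b
    using D(4)[OF mem(1)[OF that(1)] mem(1)[OF that(2)]] mem(2) that y by (simp add: N.smult_l_distr)
  have smult: "((r \<otimes>\<^bsub>R\<^esub> a) \<odot>\<^bsub>N\<^esub> y, r \<odot>\<^bsub>E\<^esub> f a) \<in> K" if "r \<in> carrier R" "a \<in> I" for r a
    using D(5)[OF that(1) mem(1)[OF that(2)]] mem(2) that y by (simp add: N.smult_assoc1)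
  have memI: "r \<in> I" if "r \<in> carrier R" "(r \<odot>\<^bsub>N\<^esub> y, v) \<in> K" for r v
    using that unfolding I_def by blast
  have "\<zero>\<^bsub>R\<^esub> \<in> I"
    by (rule memI) (use D(3) y in \<open>auto simp: N.smult_zero_left\<close>)
  moreover have "a \<oplus>\<^bsub>R\<^esub> b \<in> I" if "a \<in> I" "b \<in> I" for a b
    using memI[OF _ add[OF that]] mem(2) that by simp
  moreover have "r \<otimes>\<^bsub>R\<^esub> a \<in> I" if "r \<in> carrier R" "a \<in> I" for r a
    using memI[OF _ smult[OF that]] mem(2) that by simp
  ultimately have "left_ideal R I"
    unfolding left_ideal_def using mem(2) by blast
  moreover have "f \<in> linear_maps R (ideal_module R I) E"
    unfolding linear_maps_def using fI[OF add] fI[OF smult] D(2)[OF mem(1)] by auto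
  ultimately obtain e where e: "e \<in> carrier E" and fe: "\<And>a. a \<in> I \<Longrightarrow> f a = a \<odot>\<^bsub>E\<^esub> e"
    using \<open>baer R E\<close> unfolding baer_def by blast
  \<comment> \<open>\<open>K'\<close> is the sum of \<open>K\<close> and the cyclic submodule
    generated by \<open>(y, e)\<close>.\<close>
  define K' where "K' = {(u \<oplus>\<^bsub>N\<^esub> r \<odot>\<^bsub>N\<^esub> y, v \<oplus>\<^bsub>E\<^esub> r \<odot>\<^bsub>E\<^esub> e) | u v r. (u, v) \<in> K \<and> r \<in> carrier R}"
  have K'I: "(p, q) \<in> K'"
    if "(u, v) \<in> K" "r \<in> carrier R" "p = u \<oplus>\<^bsub>N\<^esub> r \<odot>\<^bsub>N\<^esub> y" "q = v \<oplus>\<^bsub>E\<^esub> r \<odot>\<^bsub>E\<^esub> e" for p q u v r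
    unfolding K'_def using that by blast
  have K'E: "\<exists>u v r. (u, v) \<in> K \<and> r \<in> carrier R \<and> p = u \<oplus>\<^bsub>N\<^esub> r \<odot>\<^bsub>N\<^esub> y \<and> q = v \<oplus>\<^bsub>E\<^esub> r \<odot>\<^bsub>E\<^esub> e"
    if "(p, q) \<in> K'" for p q
    using that unfolding K'_def by blast
  have "linear_graph R N E K'"
    unfolding linear_graph_def
  proof (intro conjI allI impI ballI)
    show "K' \<subseteq> carrier N \<times> carrier E"
      unfolding K'_def using D(1,2) y e by (auto intro!: N.smult_closed E.smult_closed)
    show "(\<zero>\<^bsub>N\<^esub>, \<zero>\<^bsub>E\<^esub>) \<in> K'"
      by (rule K'I[OF D(3), of "\<zero>\<^bsub>R\<^esub>"]) (use y e in \<open>auto simp: N.smult_zero_left E.smult_zero_left\<close>)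
  next
    fix p q p' q' assume "(p, q) \<in> K'" "(p', q') \<in> K'"
    then obtain u v r u' v' r' where *: "(u, v) \<in> K" "r \<in> carrier R"
      "p = u \<oplus>\<^bsub>N\<^esub> r \<odot>\<^bsub>N\<^esub> y" "q = v \<oplus>\<^bsub>E\<^esub> r \<odot>\<^bsub>E\<^esub> e" "(u', v') \<in> K" "r' \<in> carrier R"
      "p' = u' \<oplus>\<^bsub>N\<^esub> r' \<odot>\<^bsub>N\<^esub> y" "q' = v' \<oplus>\<^bsub>E\<^esub> r' \<odot>\<^bsub>E\<^esub> e"
      using K'E by meson
    show "(p \<oplus>\<^bsub>N\<^esub> p', q \<oplus>\<^bsub>E\<^esub> q') \<in> K'"
      by (rule K'I[OF D(4)[OF *(1,5)], of "r \<oplus>\<^bsub>R\<^esub> r'"])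
         (use * y e D(1,2) in \<open>auto simp: N.smult_l_distr E.smult_l_distr N.smult_closed E.smult_closed
            N.M.a_ac E.M.a_ac\<close>)
  next
    fix s p q assume s: "s \<in> carrier R" and "(p, q) \<in> K'"
    then obtain u v r where *: "(u, v) \<in> K" "r \<in> carrier R"
      "p = u \<oplus>\<^bsub>N\<^esub> r \<odot>\<^bsub>N\<^esub> y" "q = v \<oplus>\<^bsub>E\<^esub> r \<odot>\<^bsub>E\<^esub> e"
      using K'E by meson
    show "(s \<odot>\<^bsub>N\<^esub> p, s \<odot>\<^bsub>E\<^esub> q) \<in> K'"
      by (rule K'I[OF D(5)[OF s *(1)], of "s \<otimes>\<^bsub>R\<^esub> r"])
         (use * s y e D(1,2) in \<open>auto simp: N.smult_r_distr E.smult_r_distr N.smult_closed E.smult_closed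
            N.smult_assoc1 E.smult_assoc1\<close>)
  next
    \<comment> \<open>Single-valuedness is what the choice of \<open>e\<close> secures: if
      \<open>u + r y = 0\<close>, then \<open>r\<close> lies in \<open>I\<close>, and the value
      \<open>-v\<close> of \<open>K\<close> at \<open>r y\<close> equals \<open>r e\<close>, so
      \<open>v + r e = 0\<close>.\<close>
    fix q assume "(\<zero>\<^bsub>N\<^esub>, q) \<in> K'"
    then obtain u v r where *: "(u, v) \<in> K" "r \<in> carrier R"
      "\<zero>\<^bsub>N\<^esub> = u \<oplus>\<^bsub>N\<^esub> r \<odot>\<^bsub>N\<^esub> y" "q = v \<oplus>\<^bsub>E\<^esub> r \<odot>\<^bsub>E\<^esub> e"
      using K'E by meson
    have "\<ominus>\<^bsub>N\<^esub> u = r \<odot>\<^bsub>N\<^esub> y"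
      using * D(1) y N.smult_closed by (metis N.M.minus_equality N.M.a_comm)
    then have "(r \<odot>\<^bsub>N\<^esub> y, \<ominus>\<^bsub>E\<^esub> v) \<in> K"
      using linear_graph_minus[OF N E K *(1)] by simp
    then have "\<ominus>\<^bsub>E\<^esub> v = r \<odot>\<^bsub>E\<^esub> e"
      using fI fe[of r] *(2) unfolding I_def by auto
    then show "q = \<zero>\<^bsub>E\<^esub>"
      using *(1,4) D(2) E.M.r_neg by metis
  qed
  moreover have "K \<subseteq> K'"
  proof clarify
    fix u v assume uv: "(u, v) \<in> K"
    show "(u, v) \<in> K'"
      by (rule K'I[OF uv, of "\<zero>\<^bsub>R\<^esub>"])
         (use uv D(1,2) y e in \<open>auto simp: N.smult_zero_left E.smult_zero_left\<close>)
  qed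
  moreover have "(y, e) \<in> K'"
    by (rule K'I[OF D(3), of "\<one>\<^bsub>R\<^esub>"]) (use y e in \<open>auto simp: N.smult_one E.smult_one\<close>)
  ultimately show thesis
    using that by force
qed

lemma linear_maps_zero:
  assumes "left_module R M" "left_module R N" "h \<in> linear_maps R M N"
  shows "h \<zero>\<^bsub>M\<^esub> = \<zero>\<^bsub>N\<^esub>"
proof -
  interpret M: left_module R M by fact
  interpret N: left_module R N by fact
  have "h (\<zero>\<^bsub>R\<^esub> \<odot>\<^bsub>M\<^esub> \<zero>\<^bsub>M\<^esub>) = \<zero>\<^bsub>R\<^esub> \<odot>\<^bsub>N\<^esub> h \<zero>\<^bsub>M\<^esub>" "h \<zero>\<^bsub>M\<^esub> \<in> carrier N"
    using assms(3) unfolding linear_maps_def by auto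
  then show ?thesis
    by (simp add: M.smult_zero_left N.smult_zero_left)
qed

text \<open>The set is the graph of \<open>g\<close> after the inverse of \<open>i\<close>, defined
  on the image of \<open>i\<close>. Injectivity makes it single-valued: \<open>i x = 0\<close>
  forces \<open>x = 0\<close> and hence \<open>g x = 0\<close>.\<close>

lemma linear_graph_image:
  assumes "left_module R M" "left_module R N" "left_module R E"
    and "i \<in> linear_maps R M N" "g \<in> linear_maps R M E" "inj_on i (carrier M)"
  shows "linear_graph R N E ((\<lambda>x. (i x, g x)) ` carrier M)"
proof -
  interpret M: left_module R M by fact
  note z = linear_maps_zero[OF assms(1,2,4)] linear_maps_zero[OF assms(1,3,5)]
  have i: "\<And>x. x \<in> carrier M \<Longrightarrow> i x \<in> carrier N"
     "\<And>x y. x \<in> carrier M \<Longrightarrow> y \<in> carrier M \<Longrightarrow> i x \<oplus>\<^bsub>N\<^esub> i y = i (x \<oplus>\<^bsub>M\<^esub> y)"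
     "\<And>a x. a \<in> carrier R \<Longrightarrow> x \<in> carrier M \<Longrightarrow> a \<odot>\<^bsub>N\<^esub> i x = i (a \<odot>\<^bsub>M\<^esub> x)"
    and g: "\<And>x. x \<in> carrier M \<Longrightarrow> g x \<in> carrier E"
     "\<And>x y. x \<in> carrier M \<Longrightarrow> y \<in> carrier M \<Longrightarrow> g x \<oplus>\<^bsub>E\<^esub> g y = g (x \<oplus>\<^bsub>M\<^esub> y)"
     "\<And>a x. a \<in> carrier R \<Longrightarrow> x \<in> carrier M \<Longrightarrow> a \<odot>\<^bsub>E\<^esub> g x = g (a \<odot>\<^bsub>M\<^esub> x)"
    using assms(4,5) unfolding linear_maps_def by auto
  have "x = \<zero>\<^bsub>M\<^esub>" if "x \<in> carrier M" "\<zero>\<^bsub>N\<^esub> = i x" for x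
    using that z(1) assms(6) by (metis inj_onD M.M.zero_closed)
  then show ?thesis
    unfolding linear_graph_def using z i g
    by (auto simp: image_iff intro: M.smult_closed) (metis M.M.zero_closed)
qed

text \<open>Zorn's lemma gives a maximal graph containing the one of
  \<open>linear_graph_image\<close>. By \<open>linear_graph_extend\<close> its domain is all of
  \<open>N\<close>, so it is the graph of the desired extension.\<close>

theorem baer_criterion:
  assumes E: "left_module R E" and baer: "baer R E"
  shows "injective_left_module TYPE('m) TYPE('n) R E"
  unfolding injective_left_module_def
proof (intro conjI allI ballI impI)
  fix M :: "('a, 'm) module" and N :: "('a, 'n) module" and i g
  assume i: "i \<in> linear_maps R M N" and g: "g \<in> linear_maps R M E"
    and M: "left_module R M" and N: "left_module R N" and inj: "inj_on i (carrier M)"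
  let ?G = "(\<lambda>x. (i x, g x)) ` carrier M"
  let ?A = "{K. linear_graph R N E K \<and> ?G \<subseteq> K}"
  have "\<exists>K\<in>?A. \<forall>L\<in>?A. K \<subseteq> L \<longrightarrow> L = K"
  proof (rule subset_Zorn_nonempty)
    show "?A \<noteq> {}"
      using linear_graph_image[OF M N E i g inj] by auto
    fix C assume C: "C \<noteq> {}" "subset.chain ?A C"
    have lg: "linear_graph R N E K" and sub: "?G \<subseteq> K" if "K \<in> C" for K
      using C(2) that unfolding subset.chain_def by auto
    \<comment> \<open>Each closure law of \<open>linear_graph\<close> involves at most two pairs.
      Members of a chain are comparable, so two pairs always lie in a single member, where the law
      holds.\<close>
    have common: "\<exists>K\<in>C. x \<in> K \<and> y \<in> K" if xy: "x \<in> \<Union>C" "y \<in> \<Union>C" for x y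
    proof -
      obtain L L' where L: "L \<in> C" "x \<in> L" "L' \<in> C" "y \<in> L'"
        using xy by blast
      then have "L \<subseteq> L' \<or> L' \<subseteq> L"
        using C(2) unfolding subset.chain_def by blast
      with L show ?thesis
        by blast
    qed
    have "linear_graph R N E (\<Union>C)"
      unfolding linear_graph_def
    proof (intro conjI allI impI ballI)
      show "\<Union>C \<subseteq> carrier N \<times> carrier E"
        using linear_graphD(1,2)[OF lg] by auto
      show "(\<zero>\<^bsub>N\<^esub>, \<zero>\<^bsub>E\<^esub>) \<in> \<Union>C"
        using C(1) linear_graphD(3)[OF lg] by blast
      show "(u \<oplus>\<^bsub>N\<^esub> u', v \<oplus>\<^bsub>E\<^esub> v') \<in> \<Union>C" if "(u, v) \<in> \<Union>C" "(u', v') \<in> \<Union>C" for u v u' v'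
        using common[OF that] linear_graphD(4)[OF lg] by blast
      show "(r \<odot>\<^bsub>N\<^esub> u, r \<odot>\<^bsub>E\<^esub> v) \<in> \<Union>C" if "r \<in> carrier R" "(u, v) \<in> \<Union>C" for r u v
        using that linear_graphD(5)[OF lg] by blast
      show "v = \<zero>\<^bsub>E\<^esub>" if "(\<zero>\<^bsub>N\<^esub>, v) \<in> \<Union>C" for v
        using that linear_graphD(6)[OF lg] by blast
    qed
    then show "\<Union>C \<in> ?A"
      using C(1) sub by blast
  qed
  then obtain K where "K \<in> ?A" and max: "\<forall>L\<in>?A. K \<subseteq> L \<longrightarrow> L = K"
    by (rule bexE)
  then have K: "linear_graph R N E K" "?G \<subseteq> K"
    by simp_all
  note D = linear_graphD[OF K(1)]
  have total: "\<exists>v. (y, v) \<in> K" if y: "y \<in> carrier N" for y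
  proof -
    obtain K' where K': "linear_graph R N E K'" "K \<subseteq> K'" "y \<in> fst ` K'"
      by (rule linear_graph_extend[OF N E baer K(1) y])
    have "K' \<in> ?A"
      using K'(1) subset_trans[OF K(2) K'(2)] by simp
    then have "K' = K"
      using K'(2) by (rule max[rule_format])
    with K'(3) show ?thesis
      by auto
  qed
  define h where "h y = (THE v. (y, v) \<in> K)" for y
  have hI: "h y = v" if "(y, v) \<in> K" for y v
    unfolding h_def using that linear_graph_unique[OF N E K(1)] by blast
  have h: "(y, h y) \<in> K" if "y \<in> carrier N" for y
    using total[OF that] hI by auto
  have "h \<in> linear_maps R N E"
    unfolding linear_maps_def using D(2)[OF h] hI[OF D(4)[OF h h]] hI[OF D(5)[OF _ h]] by auto
  moreover have "h (i x) = g x" if "x \<in> carrier M" for x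
    using that K(2) hI by blast
  ultimately show "\<exists>h\<in>linear_maps R N E. \<forall>x\<in>carrier M. h (i x) = g x"
    by blast
qed (fact E)

section \<open>The dual basis of a projective module\<close>

context right_module
begin

lemma smult_zero_left: "x \<in> carrier M \<Longrightarrow> \<zero> \<odot>\<^bsub>M\<^esub> x = \<zero>\<^bsub>M\<^esub>"
  using smult_l_distr[of \<zero> \<zero> x] smult_closed[of \<zero> x] M.add.l_cancel_one by fastforce

lemma smult_zero_right: "a \<in> carrier R \<Longrightarrow> a \<odot>\<^bsub>M\<^esub> \<zero>\<^bsub>M\<^esub> = \<zero>\<^bsub>M\<^esub>"
  using smult_r_distr[of a "\<zero>\<^bsub>M\<^esub>" "\<zero>\<^bsub>M\<^esub>"] smult_closed[of a "\<zero>\<^bsub>M\<^esub>"] M.add.l_cancel_one by fastforce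

lemma smult_finsum:
  assumes "a \<in> carrier R" "f \<in> A \<rightarrow> carrier M"
  shows "a \<odot>\<^bsub>M\<^esub> (\<Oplus>\<^bsub>M\<^esub>k\<in>A. f k) = (\<Oplus>\<^bsub>M\<^esub>k\<in>A. a \<odot>\<^bsub>M\<^esub> f k)"
  using assms(2)
proof (induction A rule: infinite_finite_induct)
  case (insert k A)
  then show ?case
    using assms(1) by (subst (1 2) M.finsum_insert) (auto simp: smult_r_distr smult_closed Pi_iff)
qed (use assms(1) in \<open>auto simp: smult_zero_right\<close>)

end

section \<open>Finitely supported functions and the canonical epimorphism\<close>

text \<open>This is the free right module on \<open>B\<close>. Its elements are total functions
  vanishing off \<open>B\<close>, so equality in the module is equality of functions. Scalars
  multiply from the right because \<open>smult\<close> holds the right action.\<close>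

definition finsupp_module ::
    "('r, 'k) ring_scheme \<Rightarrow> 'p set \<Rightarrow> ('r, 'p \<Rightarrow> 'r) module"
  where "finsupp_module R B =
    \<lparr>carrier = {\<phi>. range \<phi> \<subseteq> carrier R \<and> finite {k. \<phi> k \<noteq> \<zero>\<^bsub>R\<^esub>} \<and> {k. \<phi> k \<noteq> \<zero>\<^bsub>R\<^esub>} \<subseteq> B},
     monoid.mult = undefined, monoid.one = undefined,
     ring.zero = (\<lambda>_. \<zero>\<^bsub>R\<^esub>), ring.add = (\<lambda>\<phi> \<psi> k. \<phi> k \<oplus>\<^bsub>R\<^esub> \<psi> k),
     smult = (\<lambda>a \<phi> k. \<phi> k \<otimes>\<^bsub>R\<^esub> a)\<rparr>"

lemma finsupp_module_simps [simp]:
  "\<zero>\<^bsub>finsupp_module R B\<^esub> = (\<lambda>_. \<zero>\<^bsub>R\<^esub>)"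
  "\<phi> \<oplus>\<^bsub>finsupp_module R B\<^esub> \<psi> = (\<lambda>k. \<phi> k \<oplus>\<^bsub>R\<^esub> \<psi> k)"
  "a \<odot>\<^bsub>finsupp_module R B\<^esub> \<phi> = (\<lambda>k. \<phi> k \<otimes>\<^bsub>R\<^esub> a)"
  by (simp_all add: finsupp_module_def)

lemma finsupp_moduleD:
  assumes "\<phi> \<in> carrier (finsupp_module R B)"
  shows "\<phi> k \<in> carrier R" "finite {k. \<phi> k \<noteq> \<zero>\<^bsub>R\<^esub>}" "{k. \<phi> k \<noteq> \<zero>\<^bsub>R\<^esub>} \<subseteq> B"
  using assms unfolding finsupp_module_def by auto

text \<open>Any finite \<open>A\<close> containing the support will do, since the exact support of a
  sum or a multiple can be smaller than the obvious bound.\<close>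

lemma finsupp_moduleI:
  assumes "\<And>k. \<phi> k \<in> carrier R" "finite A" "A \<subseteq> B" "\<And>k. k \<notin> A \<Longrightarrow> \<phi> k = \<zero>\<^bsub>R\<^esub>"
  shows "\<phi> \<in> carrier (finsupp_module R B)"
proof -
  have "{k. \<phi> k \<noteq> \<zero>\<^bsub>R\<^esub>} \<subseteq> A"
    using assms(4) by blast
  then show ?thesis
    unfolding finsupp_module_def using assms(1-3) by (auto intro: finite_subset)
qed

lemma right_module_finsupp:
  assumes "ring R"
  shows "right_module R (finsupp_module R B)"
proof -
  interpret ring R by fact
  note D = finsupp_moduleD[of _ R B]
  have add: "(\<lambda>k. \<phi> k \<oplus>\<^bsub>R\<^esub> \<psi> k) \<in> carrier (finsupp_module R B)"
    if "\<phi> \<in> carrier (finsupp_module R B)" "\<psi> \<in> carrier (finsupp_module R B)" for \<phi> \<psi>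
    by (rule finsupp_moduleI[where A = "{k. \<phi> k \<noteq> \<zero>\<^bsub>R\<^esub>} \<union> {k. \<psi> k \<noteq> \<zero>\<^bsub>R\<^esub>}"])
       (use D[OF that(1)] D[OF that(2)] in auto)
  have smult: "(\<lambda>k. \<phi> k \<otimes>\<^bsub>R\<^esub> a) \<in> carrier (finsupp_module R B)"
    if "\<phi> \<in> carrier (finsupp_module R B)" "a \<in> carrier R" for \<phi> a
    by (rule finsupp_moduleI[where A = "{k. \<phi> k \<noteq> \<zero>\<^bsub>R\<^esub>}"]) (use D[OF that(1)] that(2) in auto)
  have zero: "(\<lambda>_. \<zero>\<^bsub>R\<^esub>) \<in> carrier (finsupp_module R B)"
    by (rule finsupp_moduleI[where A = "{}"]) auto
  have neg: "\<exists>\<psi>\<in>carrier (finsupp_module R B). (\<lambda>k. \<phi> k \<oplus>\<^bsub>R\<^esub> \<psi> k) = (\<lambda>_. \<zero>\<^bsub>R\<^esub>)"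
    if "\<phi> \<in> carrier (finsupp_module R B)" for \<phi>
  proof
    show "(\<lambda>k. \<ominus>\<^bsub>R\<^esub> \<phi> k) \<in> carrier (finsupp_module R B)"
      by (rule finsupp_moduleI[where A = "{k. \<phi> k \<noteq> \<zero>\<^bsub>R\<^esub>}"]) (use D[OF that] in auto)
    show "(\<lambda>k. \<phi> k \<oplus>\<^bsub>R\<^esub> \<ominus>\<^bsub>R\<^esub> \<phi> k) = (\<lambda>_. \<zero>\<^bsub>R\<^esub>)"
      using D(1)[OF that] by (simp add: r_neg)
  qed
  have "abelian_group (finsupp_module R B)"
    by (rule abelian_groupI) (simp_all add: add zero neg D(1) a_ac)
  then show ?thesis
    unfolding right_module_def right_module_axioms_def
    using assms by (simp add: smult D(1) l_distr r_distr m_assoc)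
qed

text \<open>This is the canonical map from the free module on the elements of \<open>P\<close> to
  \<open>P\<close>; it sends the basis element at \<open>k\<close> to \<open>k\<close>.\<close>

definition evaluate ::
    "('r, 'k) ring_scheme \<Rightarrow> ('r, 'p, 'c) module_scheme \<Rightarrow> ('p \<Rightarrow> 'r) \<Rightarrow> 'p"
  where "evaluate R P \<phi> = (\<Oplus>\<^bsub>P\<^esub>k\<in>{k. \<phi> k \<noteq> \<zero>\<^bsub>R\<^esub>}. \<phi> k \<odot>\<^bsub>P\<^esub> k)"

text \<open>The additional terms have coefficient zero. This allows elements with different supports
  to be evaluated over one common index set.\<close>

lemma evaluate_superset:
  assumes "right_module R P" "\<phi> \<in> carrier (finsupp_module R (carrier P))"
    and "finite A" "A \<subseteq> carrier P" "{k. \<phi> k \<noteq> \<zero>\<^bsub>R\<^esub>} \<subseteq> A"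
  shows "evaluate R P \<phi> = (\<Oplus>\<^bsub>P\<^esub>k\<in>A. \<phi> k \<odot>\<^bsub>P\<^esub> k)"
proof -
  interpret right_module R P by fact
  note D = finsupp_moduleD[OF assms(2)]
  show ?thesis
    unfolding evaluate_def using assms(3-5) D(1)
    by (intro M.add.finprod_mono_neutral_cong_left)
       (auto simp: smult_zero_left subset_iff intro!: smult_closed)
qed

lemma evaluate_linear:
  assumes "right_module R P"
  shows "evaluate R P \<in> linear_maps R (finsupp_module R (carrier P)) P"
proof -
  interpret right_module R P by fact
  let ?F = "finsupp_module R (carrier P)"
  interpret F: right_module R ?F by (rule right_module_finsupp) unfold_locales
  note D = finsupp_moduleD[of _ R "carrier P"]
  have closed: "(\<Oplus>\<^bsub>P\<^esub>k\<in>A. \<phi> k \<odot>\<^bsub>P\<^esub> k) \<in> carrier P" if "\<phi> \<in> carrier ?F" "A \<subseteq> carrier P" for \<phi> A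
    using D(1)[OF that(1)] that(2) by (intro M.finsum_closed) (auto intro!: smult_closed)
  have "evaluate R P \<phi> \<in> carrier P" if "\<phi> \<in> carrier ?F" for \<phi>
    unfolding evaluate_def using closed[OF that D(3)[OF that]] .
  moreover have "evaluate R P (\<phi> \<oplus>\<^bsub>?F\<^esub> \<psi>) = evaluate R P \<phi> \<oplus>\<^bsub>P\<^esub> evaluate R P \<psi>"
    if \<phi>: "\<phi> \<in> carrier ?F" and \<psi>: "\<psi> \<in> carrier ?F" for \<phi> \<psi>
  proof -
    define A where "A = {k. \<phi> k \<noteq> \<zero>\<^bsub>R\<^esub>} \<union> {k. \<psi> k \<noteq> \<zero>\<^bsub>R\<^esub>}"
    have A: "finite A" "A \<subseteq> carrier P"
      using D(2,3)[OF \<phi>] D(2,3)[OF \<psi>] unfolding A_def by auto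
    have "evaluate R P (\<phi> \<oplus>\<^bsub>?F\<^esub> \<psi>) = (\<Oplus>\<^bsub>P\<^esub>k\<in>A. (\<phi> \<oplus>\<^bsub>?F\<^esub> \<psi>) k \<odot>\<^bsub>P\<^esub> k)"
      by (rule evaluate_superset[OF assms F.M.a_closed[OF \<phi> \<psi>] A]) (auto simp: A_def)
    also have "\<dots> = (\<Oplus>\<^bsub>P\<^esub>k\<in>A. \<phi> k \<odot>\<^bsub>P\<^esub> k \<oplus>\<^bsub>P\<^esub> \<psi> k \<odot>\<^bsub>P\<^esub> k)"
      using A D(1)[OF \<phi>] D(1)[OF \<psi>]
      by (intro M.finsum_cong') (auto simp: smult_l_distr subset_iff intro!: smult_closed)
    also have "\<dots> = (\<Oplus>\<^bsub>P\<^esub>k\<in>A. \<phi> k \<odot>\<^bsub>P\<^esub> k) \<oplus>\<^bsub>P\<^esub> (\<Oplus>\<^bsub>P\<^esub>k\<in>A. \<psi> k \<odot>\<^bsub>P\<^esub> k)"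
      using A D(1)[OF \<phi>] D(1)[OF \<psi>]
      by (intro M.finsum_addf) (auto simp: subset_iff intro!: smult_closed)
    also have "\<dots> = evaluate R P \<phi> \<oplus>\<^bsub>P\<^esub> evaluate R P \<psi>"
      using evaluate_superset[OF assms \<phi> A] evaluate_superset[OF assms \<psi> A] by (auto simp: A_def)
    finally show ?thesis .
  qed
  moreover have "evaluate R P (a \<odot>\<^bsub>?F\<^esub> \<phi>) = a \<odot>\<^bsub>P\<^esub> evaluate R P \<phi>"
    if a: "a \<in> carrier R" and \<phi>: "\<phi> \<in> carrier ?F" for a \<phi>
  proof -
    \<comment> \<open>Multiplication by \<open>a\<close> may shrink the support, so the support of
      \<open>\<phi>\<close> serves as index set on both sides.\<close>
    define A where "A = {k. \<phi> k \<noteq> \<zero>\<^bsub>R\<^esub>}"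
    have A: "finite A" "A \<subseteq> carrier P"
      using D(2,3)[OF \<phi>] unfolding A_def by auto
    have "evaluate R P (a \<odot>\<^bsub>?F\<^esub> \<phi>) = (\<Oplus>\<^bsub>P\<^esub>k\<in>A. (a \<odot>\<^bsub>?F\<^esub> \<phi>) k \<odot>\<^bsub>P\<^esub> k)"
      by (rule evaluate_superset[OF assms F.smult_closed[OF a \<phi>] A]) (use a in \<open>auto simp: A_def\<close>)
    also have "\<dots> = (\<Oplus>\<^bsub>P\<^esub>k\<in>A. a \<odot>\<^bsub>P\<^esub> (\<phi> k \<odot>\<^bsub>P\<^esub> k))"
      using A D(1)[OF \<phi>] a
      by (intro M.finsum_cong') (auto simp: smult_assoc1 subset_iff intro!: smult_closed)
    also have "\<dots> = a \<odot>\<^bsub>P\<^esub> evaluate R P \<phi>"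
      unfolding evaluate_def A_def[symmetric] using A D(1)[OF \<phi>] a
      by (subst smult_finsum) (auto simp: subset_iff intro!: smult_closed)
    finally show ?thesis .
  qed
  ultimately show ?thesis
    unfolding linear_maps_def by blast
qed

text \<open>Each \<open>x\<close> is the image of the basis element at \<open>x\<close>.\<close>

lemma evaluate_surj:
  assumes "right_module R P"
  shows "evaluate R P ` carrier (finsupp_module R (carrier P)) = carrier P"
proof -
  interpret right_module R P by fact
  let ?F = "finsupp_module R (carrier P)"
  have "x \<in> evaluate R P ` carrier ?F" if x: "x \<in> carrier P" for x
  proof
    let ?\<delta> = "\<lambda>k. if k = x then \<one>\<^bsub>R\<^esub> else \<zero>\<^bsub>R\<^esub>"
    show \<delta>: "?\<delta> \<in> carrier ?F"
      by (rule finsupp_moduleI[where A = "{x}"]) (use x in auto)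
    have "evaluate R P ?\<delta> = (\<Oplus>\<^bsub>P\<^esub>k\<in>{x}. ?\<delta> k \<odot>\<^bsub>P\<^esub> k)"
      by (rule evaluate_superset[OF assms \<delta>]) (use x in auto)
    then show "x = evaluate R P ?\<delta>"
      using x by (simp add: smult_one)
  qed
  then show ?thesis
    using evaluate_linear[OF assms] unfolding linear_maps_def by blast
qed

text \<open>Lifting the identity of \<open>P\<close> along the epimorphism \<open>evaluate\<close>
  gives a linear section \<open>h\<close>. The maps sending \<open>x\<close> to \<open>h x k\<close>
  are the coordinate functionals of a dual basis, with all elements \<open>k\<close> of
  \<open>P\<close> as generators.\<close>

lemma projective_dual_basis:
  fixes P :: "('r, 'p) module" and R :: "('r, 'k) ring_scheme"
  assumes "projective_right_module TYPE('p \<Rightarrow> 'r) TYPE('p) R P"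
  obtains h where "h \<in> linear_maps R P (finsupp_module R (carrier P))"
    "\<And>x. x \<in> carrier P \<Longrightarrow> evaluate R P (h x) = x"
proof -
  let ?F = "finsupp_module R (carrier P)"
  have P: "right_module R P"
    using assms unfolding projective_right_module_def by blast
  then have F: "right_module R ?F"
    using right_module_finsupp right_module.axioms(1) by blast
  have "(\<lambda>x. x) \<in> linear_maps R P P"
    unfolding linear_maps_def by auto
  then have "\<exists>h\<in>linear_maps R P ?F. \<forall>x\<in>carrier P. evaluate R P (h x) = x"
    by (rule assms[unfolded projective_right_module_def, THEN conjunct2, rule_format,
          OF evaluate_linear[OF P] _ F P evaluate_surj[OF P]])
  then show thesis
    using that by blast
qed

section \<open>Restriction of scalars\<close>

lemma left_module_restrict_scalars:
  assumes "left_module S E" "subring R S"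
  shows "left_module (S\<lparr>carrier := R\<rparr>) E"
proof -
  interpret left_module S E by fact
  show ?thesis
    unfolding left_module_def left_module_axioms_def
    using R.subring_is_ring[OF assms(2)] M.abelian_group_axioms subringE(1)[OF assms(2)]
    by (auto simp: smult_closed smult_l_distr smult_r_distr smult_assoc1 smult_one subset_iff)
qed

section \<open>The left ideal generated by a subset\<close>

text \<open>For an ideal \<open>I\<close> of \<open>R\<close> this is \<open>S I\<close>. Elements
  are built by one summand \<open>s a\<close> at a time, so that facts about finite sums of such
  products become inductions.\<close>

inductive_set left_ideal_span :: "('s, 'k) ring_scheme \<Rightarrow> 's set \<Rightarrow> 's set"
  for S :: "('s, 'k) ring_scheme" and I :: "'s set"
  where zero: "\<zero>\<^bsub>S\<^esub> \<in> left_ideal_span S I"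
  | add: "\<lbrakk>s \<in> carrier S; a \<in> I; x \<in> left_ideal_span S I\<rbrakk> \<Longrightarrow>
      s \<otimes>\<^bsub>S\<^esub> a \<oplus>\<^bsub>S\<^esub> x \<in> left_ideal_span S I"

lemma left_ideal_span:
  assumes "ring S" "I \<subseteq> carrier S"
  shows "left_ideal S (left_ideal_span S I)"
proof -
  interpret ring S by fact
  let ?J = "left_ideal_span S I"
  have sub: "x \<in> carrier S" if "x \<in> ?J" for x
    using that by induction (use assms(2) in auto)
  have "x \<oplus>\<^bsub>S\<^esub> y \<in> ?J" if "x \<in> ?J" "y \<in> ?J" for x y
    using that(1)
  proof induction
    case zero
    then show ?case using that(2) sub by simp
  next
    case (add s a x)
    then show ?case
      using left_ideal_span.add[OF add(1,2) add(4)] sub that(2) assms(2)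
      by (simp add: a_assoc subset_iff)
  qed
  moreover have "r \<otimes>\<^bsub>S\<^esub> x \<in> ?J" if "x \<in> ?J" "r \<in> carrier S" for r x
    using that(1)
  proof induction
    case zero
    then show ?case using that(2) left_ideal_span.zero by simp
  next
    case (add s a x)
    then show ?case
      using left_ideal_span.add[of "r \<otimes>\<^bsub>S\<^esub> s" S a I "r \<otimes>\<^bsub>S\<^esub> x"] sub that(2) assms(2)
      by (simp add: r_distr m_assoc subset_iff)
  qed
  ultimately show ?thesis
    unfolding left_ideal_def using sub left_ideal_span.zero by blast
qed

lemma subset_left_ideal_span:
  assumes "ring S" "I \<subseteq> carrier S"
  shows "I \<subseteq> left_ideal_span S I"
proof
  interpret ring S by fact
  fix a assume "a \<in> I"
  then show "a \<in> left_ideal_span S I"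
    using left_ideal_span.add[OF one_closed _ left_ideal_span.zero] assms(2) by (force simp: subset_iff)
qed

section \<open>Baer's condition over \<open>S\<close> and its descent to \<open>R\<close>\<close>

text \<open>The map on \<open>I\<close> is extended along the inclusion of \<open>I\<close> into
  \<open>S\<close>, and \<open>e\<close> is the value of the extension at one.\<close>

lemma baer_of_injective:
  fixes S :: "('s, 'k) ring_scheme"
  assumes "injective_left_module TYPE('s) TYPE('s) S E"
  shows "baer S E"
  unfolding baer_def
proof (intro allI impI)
  interpret left_module S E
    using assms unfolding injective_left_module_def by blast
  fix I f assume I: "left_ideal S I" and f: "f \<in> linear_maps S (ideal_module S I) E"
  have sub: "I \<subseteq> carrier S"
    using I unfolding left_ideal_def by blast
  have "left_ideal S (carrier S)"
    unfolding left_ideal_def by auto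
  then have mods: "left_module S (ideal_module S I)" "left_module S (ideal_module S (carrier S))"
    using I left_module_ideal_module R.ring_axioms by blast+
  have "(\<lambda>x. x) \<in> linear_maps S (ideal_module S I) (ideal_module S (carrier S))"
    unfolding linear_maps_def using sub by auto
  moreover have "inj_on (\<lambda>x. x) (carrier (ideal_module S I))"
    by simp
  ultimately obtain h where h: "h \<in> linear_maps S (ideal_module S (carrier S)) E"
    and hf: "\<forall>x\<in>carrier (ideal_module S I). h x = f x"
    using bexE[OF assms[unfolded injective_left_module_def, THEN conjunct2, rule_format, OF _ f mods]]
    by metis
  have "h \<one>\<^bsub>S\<^esub> \<in> carrier E" and hS: "\<And>a x. a \<in> carrier S \<Longrightarrow> x \<in> carrier S \<Longrightarrow> h (a \<otimes>\<^bsub>S\<^esub> x) = a \<odot>\<^bsub>E\<^esub> h x"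
    using h unfolding linear_maps_def by auto
  moreover have "f a = a \<odot>\<^bsub>E\<^esub> h \<one>\<^bsub>S\<^esub>" if "a \<in> I" for a
    using hf hS[of a "\<one>\<^bsub>S\<^esub>"] that sub by (auto simp: subset_iff)
  ultimately show "\<exists>e\<in>carrier E. \<forall>a\<in>I. f a = a \<odot>\<^bsub>E\<^esub> e"
    by blast
qed

lemma right_module_of_ring_simps [simp]:
  "carrier (right_module_of_ring S) = carrier S" "\<zero>\<^bsub>right_module_of_ring S\<^esub> = \<zero>\<^bsub>S\<^esub>"
  "x \<oplus>\<^bsub>right_module_of_ring S\<^esub> y = x \<oplus>\<^bsub>S\<^esub> y" "a \<odot>\<^bsub>right_module_of_ring S\<^esub> x = x \<otimes>\<^bsub>S\<^esub> a"
  by (simp_all add: right_module_of_ring_def)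

text \<open>A finite sum depends only on carrier, zero and addition, which the two structures
  share.\<close>

lemma finsum_right_module_of_ring: "finsum (right_module_of_ring S) f A = finsum S f A"
  by (simp add: finsum_def finprod_def right_module_of_ring_def)

text \<open>The coordinates of the dual basis transport \<open>g\<close> from \<open>I\<close> to an
  \<open>S\<close>-linear map \<open>f\<close> on \<open>S I\<close>, which Baer's condition over
  \<open>S\<close> represents by an element of \<open>E\<close>. The same element represents
  \<open>g\<close>.\<close>

theorem baer_restrict_scalars:
  fixes S :: "('s, 'k) ring_scheme" and E :: "('s, 'e, 'c) module_scheme"
  assumes E: "left_module S E" and "baer S E" and "subring R S"
    and proj: "projective_right_module TYPE('s \<Rightarrow> 's) TYPE('s) (S\<lparr>carrier := R\<rparr>) (right_module_of_ring S)"
  shows "baer (S\<lparr>carrier := R\<rparr>) E"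
  unfolding baer_def
proof (intro allI impI)
  interpret left_module S E by fact
  have R: "R \<subseteq> carrier S"
    using subringE(1)[OF \<open>subring R S\<close>] .
  fix I g assume I: "left_ideal (S\<lparr>carrier := R\<rparr>) I"
    and g: "g \<in> linear_maps (S\<lparr>carrier := R\<rparr>) (ideal_module (S\<lparr>carrier := R\<rparr>) I) E"
  have IR: "I \<subseteq> R" "\<zero>\<^bsub>S\<^esub> \<in> I" "\<And>a b. a \<in> I \<Longrightarrow> b \<in> I \<Longrightarrow> a \<oplus>\<^bsub>S\<^esub> b \<in> I"
    "\<And>r a. r \<in> R \<Longrightarrow> a \<in> I \<Longrightarrow> r \<otimes>\<^bsub>S\<^esub> a \<in> I"
    using I unfolding left_ideal_def by auto
  have IS: "I \<subseteq> carrier S"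
    using IR(1) R by blast
  have g: "\<And>a. a \<in> I \<Longrightarrow> g a \<in> carrier E"
    "\<And>a b. a \<in> I \<Longrightarrow> b \<in> I \<Longrightarrow> g (a \<oplus>\<^bsub>S\<^esub> b) = g a \<oplus>\<^bsub>E\<^esub> g b"
    "\<And>r a. r \<in> R \<Longrightarrow> a \<in> I \<Longrightarrow> g (r \<otimes>\<^bsub>S\<^esub> a) = r \<odot>\<^bsub>E\<^esub> g a"
    and "g \<zero>\<^bsub>ideal_module (S\<lparr>carrier := R\<rparr>) I\<^esub> = \<zero>\<^bsub>E\<^esub>"
    using g linear_maps_zero[OF left_module_ideal_module left_module_restrict_scalars[OF E] g]
      R.subring_is_ring \<open>subring R S\<close> I
    unfolding linear_maps_def by auto
  then have g0: "g \<zero>\<^bsub>S\<^esub> = \<zero>\<^bsub>E\<^esub>"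
    by simp
  obtain h where h: "h \<in> linear_maps (S\<lparr>carrier := R\<rparr>) (right_module_of_ring S)
        (finsupp_module (S\<lparr>carrier := R\<rparr>) (carrier S))"
    and eval: "\<And>x. x \<in> carrier S \<Longrightarrow> evaluate (S\<lparr>carrier := R\<rparr>) (right_module_of_ring S) (h x) = x"
    using projective_dual_basis[OF proj] by auto
  define supp where "supp x = {k. h x k \<noteq> \<zero>\<^bsub>S\<^esub>}" for x
  have hF: "h x \<in> carrier (finsupp_module (S\<lparr>carrier := R\<rparr>) (carrier S))" if "x \<in> carrier S" for x
    using h that unfolding linear_maps_def by auto
  have hR: "h x k \<in> R" and supp: "finite (supp x)" "supp x \<subseteq> carrier S" if "x \<in> carrier S" for x k
    using finsupp_moduleD[OF hF[OF that]] unfolding supp_def by auto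
  have h_add: "h (x \<oplus>\<^bsub>S\<^esub> y) k = h x k \<oplus>\<^bsub>S\<^esub> h y k" if "x \<in> carrier S" "y \<in> carrier S" for x y k
    using h that unfolding linear_maps_def by auto
  have h_smult: "h (x \<otimes>\<^bsub>S\<^esub> a) k = h x k \<otimes>\<^bsub>S\<^esub> a" if "x \<in> carrier S" "a \<in> R" for x a k
    using h that unfolding linear_maps_def by auto
  \<comment> \<open>In \<open>right_module_of_ring\<close> the scalar stands on the right, so
    evaluating \<open>h x\<close> yields the products \<open>k \<otimes> h x k\<close> in this
    order.\<close>
  have dual: "(\<Oplus>\<^bsub>S\<^esub>k\<in>supp x. k \<otimes>\<^bsub>S\<^esub> h x k) = x" if "x \<in> carrier S" for x
    using eval[OF that] unfolding evaluate_def supp_def by (simp add: finsum_right_module_of_ring)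
  have h0: "h \<zero>\<^bsub>S\<^esub> k = \<zero>\<^bsub>S\<^esub>" for k
    using h_smult[of "\<zero>\<^bsub>S\<^esub>" "\<zero>\<^bsub>S\<^esub>" k] hR[of "\<zero>\<^bsub>S\<^esub>" k] IR(1,2) R by (auto simp: subset_iff)

  \<comment> \<open>The formula makes sense for \<open>x\<close> in \<open>?J\<close>: there the
    coordinates \<open>h x k\<close> lie in \<open>I\<close>, the domain on which \<open>g\<close>
    is controlled.\<close>
  define f where "f x = (\<Oplus>\<^bsub>E\<^esub>k\<in>supp x. k \<odot>\<^bsub>E\<^esub> g (h x k))" for x
  let ?J = "left_ideal_span S I"
  have J: "left_ideal S ?J"
    by (rule left_ideal_span[OF R.ring_axioms IS])
  have JS: "x \<in> carrier S" if "x \<in> ?J" for x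
    using J that unfolding left_ideal_def by blast
  \<comment> \<open>Right linearity gives \<open>h (s a + x) k = (h s k) a + h x k\<close>. The
    first summand lies in \<open>I\<close> because \<open>h s k\<close> is in \<open>R\<close> and
    \<open>a\<close> in \<open>I\<close>.\<close>
  have hJ: "h x k \<in> I" if "x \<in> ?J" for x k
    using that
  proof induction
    case zero
    then show ?case using IR(2) h0 by simp
  next
    case (add s a x)
    then show ?case
      using IR(1,3,4) JS IS by (auto simp: h_add h_smult hR subset_iff)
  qed
  have term_closed: "k \<odot>\<^bsub>E\<^esub> g (h x k) \<in> carrier E" if "x \<in> ?J" "k \<in> carrier S" for x k
    using hJ[OF that(1)] g(1) that(2) smult_closed by blast
  \<comment> \<open>Off the support \<open>g\<close> is evaluated at zero, so by \<open>g0\<close>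
    the additional terms vanish. Sums for different \<open>x\<close> can thus be taken over one
    index set.\<close>
  have f_superset: "f x = (\<Oplus>\<^bsub>E\<^esub>k\<in>A. k \<odot>\<^bsub>E\<^esub> g (h x k))"
    if "x \<in> ?J" "finite A" "A \<subseteq> carrier S" "supp x \<subseteq> A" for x A
    unfolding f_def using that term_closed[OF that(1)] g0
    by (intro M.add.finprod_mono_neutral_cong_left) (auto simp: smult_zero_right supp_def subset_iff)
  have f_closed: "f x \<in> carrier E" if "x \<in> ?J" for x
    unfolding f_def using term_closed[OF that] supp(2)[OF JS[OF that]]
    by (intro M.finsum_closed) auto
  have f_add: "f (x \<oplus>\<^bsub>S\<^esub> y) = f x \<oplus>\<^bsub>E\<^esub> f y" if x: "x \<in> ?J" and y: "y \<in> ?J" for x y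
  proof -
    define A where "A = supp x \<union> supp y"
    have A: "finite A" "A \<subseteq> carrier S"
      using supp[OF JS[OF x]] supp[OF JS[OF y]] unfolding A_def by auto
    have xy: "x \<oplus>\<^bsub>S\<^esub> y \<in> ?J"
      using J x y unfolding left_ideal_def by blast
    have "f (x \<oplus>\<^bsub>S\<^esub> y) = (\<Oplus>\<^bsub>E\<^esub>k\<in>A. k \<odot>\<^bsub>E\<^esub> g (h (x \<oplus>\<^bsub>S\<^esub> y) k))"
      by (rule f_superset[OF xy A]) (auto simp: supp_def A_def h_add JS x y)
    also have "\<dots> = (\<Oplus>\<^bsub>E\<^esub>k\<in>A. k \<odot>\<^bsub>E\<^esub> g (h x k) \<oplus>\<^bsub>E\<^esub> k \<odot>\<^bsub>E\<^esub> g (h y k))"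
      using A(2) term_closed[OF x] term_closed[OF y]
      by (intro M.finsum_cong')
         (auto simp: h_add JS x y g(1,2) hJ smult_r_distr subset_iff)
    also have "\<dots> = (\<Oplus>\<^bsub>E\<^esub>k\<in>A. k \<odot>\<^bsub>E\<^esub> g (h x k)) \<oplus>\<^bsub>E\<^esub> (\<Oplus>\<^bsub>E\<^esub>k\<in>A. k \<odot>\<^bsub>E\<^esub> g (h y k))"
      using A(2) term_closed[OF x] term_closed[OF y] by (intro M.finsum_addf) auto
    also have "\<dots> = f x \<oplus>\<^bsub>E\<^esub> f y"
      using f_superset[OF x A] f_superset[OF y A] unfolding A_def by simp
    finally show ?thesis .
  qed
  have multJ: "s \<otimes>\<^bsub>S\<^esub> x \<in> ?J" if "s \<in> carrier S" "x \<in> ?J" for s x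
    using J that unfolding left_ideal_def by blast
  have IJ: "a \<in> ?J" if "a \<in> I" for a
    using that subset_left_ideal_span[OF R.ring_axioms IS] by blast
  \<comment> \<open>This is the key identity. Since \<open>h (s a) k = (h s k) a\<close>, linearity
    of \<open>g\<close> over \<open>R\<close> moves \<open>h s k\<close> out of \<open>g\<close>;
    the coefficients of \<open>g a\<close> then add up to \<open>s\<close> by
    \<open>dual\<close>.\<close>
  have f_mult: "f (s \<otimes>\<^bsub>S\<^esub> a) = s \<odot>\<^bsub>E\<^esub> g a" if s: "s \<in> carrier S" and a: "a \<in> I" for s a
  proof -
    have aR: "a \<in> R" "a \<in> carrier S"
      using a IR(1) R by auto
    have hS: "h s k \<in> carrier S" for k
      using hR[OF s] R by blast
    have "f (s \<otimes>\<^bsub>S\<^esub> a) = (\<Oplus>\<^bsub>E\<^esub>k\<in>supp s. k \<odot>\<^bsub>E\<^esub> g (h (s \<otimes>\<^bsub>S\<^esub> a) k))"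
      by (rule f_superset[OF multJ[OF s IJ[OF a]] supp[OF s]])
         (use aR in \<open>auto simp: supp_def h_smult s\<close>)
    also have "\<dots> = (\<Oplus>\<^bsub>E\<^esub>k\<in>supp s. (k \<otimes>\<^bsub>S\<^esub> h s k) \<odot>\<^bsub>E\<^esub> g a)"
      using supp(2)[OF s] hS
      by (intro M.finsum_cong')
         (auto simp: h_smult s aR g(1,3) a hR smult_assoc1 subset_iff intro!: smult_closed)
    also have "\<dots> = (\<Oplus>\<^bsub>S\<^esub>k\<in>supp s. k \<otimes>\<^bsub>S\<^esub> h s k) \<odot>\<^bsub>E\<^esub> g a"
      using supp(2)[OF s] hS g(1)[OF a] by (subst finsum_smult) (auto simp: subset_iff)
    also have "\<dots> = s \<odot>\<^bsub>E\<^esub> g a"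
      using dual[OF s] by simp
    finally show ?thesis .
  qed
  have f0: "f \<zero>\<^bsub>S\<^esub> = \<zero>\<^bsub>E\<^esub>"
    unfolding f_def supp_def using h0 by simp
  \<comment> \<open>By additivity it is enough to treat the generators \<open>s a\<close>, where
    \<open>f_mult\<close> gives \<open>f (t s a) = t s g(a) = t f (s a)\<close>.\<close>
  have f_smult: "f (t \<otimes>\<^bsub>S\<^esub> x) = t \<odot>\<^bsub>E\<^esub> f x" if t: "t \<in> carrier S" and x: "x \<in> ?J" for t x
    using x
  proof induction
    case zero
    then show ?case using t f0 by (simp add: smult_zero_right)
  next
    case (add s a x)
    have a: "a \<in> carrier S"
      using add(2) IS by blast
    have "f (t \<otimes>\<^bsub>S\<^esub> (s \<otimes>\<^bsub>S\<^esub> a \<oplus>\<^bsub>S\<^esub> x)) = f ((t \<otimes>\<^bsub>S\<^esub> s) \<otimes>\<^bsub>S\<^esub> a \<oplus>\<^bsub>S\<^esub> t \<otimes>\<^bsub>S\<^esub> x)"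
      using t add(1) a JS[OF add(3)] by (simp add: R.r_distr R.m_assoc)
    also have "\<dots> = (t \<otimes>\<^bsub>S\<^esub> s) \<odot>\<^bsub>E\<^esub> g a \<oplus>\<^bsub>E\<^esub> t \<odot>\<^bsub>E\<^esub> f x"
      using t add by (simp add: f_add multJ IJ f_mult)
    also have "\<dots> = t \<odot>\<^bsub>E\<^esub> (s \<odot>\<^bsub>E\<^esub> g a \<oplus>\<^bsub>E\<^esub> f x)"
      using t add(1,2,3) by (simp add: smult_assoc1 smult_r_distr smult_closed g(1) f_closed)
    also have "s \<odot>\<^bsub>E\<^esub> g a \<oplus>\<^bsub>E\<^esub> f x = f (s \<otimes>\<^bsub>S\<^esub> a \<oplus>\<^bsub>S\<^esub> x)"
      using add by (simp add: f_add multJ IJ f_mult)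
    finally show ?case .
  qed
  have "f \<in> linear_maps S (ideal_module S ?J) E"
    unfolding linear_maps_def using f_closed f_add f_smult by auto
  then obtain e where e: "e \<in> carrier E" "\<And>x. x \<in> ?J \<Longrightarrow> f x = x \<odot>\<^bsub>E\<^esub> e"
    using \<open>baer S E\<close> J unfolding baer_def by blast
  \<comment> \<open>Taking \<open>s\<close> to be one in \<open>f_mult\<close> shows that
    \<open>f\<close> extends \<open>g\<close>.\<close>
  have "g a = a \<odot>\<^bsub>E\<^esub> e" if "a \<in> I" for a
    using e(2)[OF IJ[OF that]] f_mult[OF R.one_closed that] that IS g(1)
    by (auto simp: smult_one subset_iff)
  then show "\<exists>e\<in>carrier E. \<forall>a\<in>I. g a = a \<odot>\<^bsub>E\<^esub> e"
    using e(1) by blast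
qed

theorem theorem1:
  fixes S :: "('s, 'k) ring_scheme"
    and R :: "'s set"
    and E :: "('s, 'e, 'c) module_scheme"
  assumes "ring S"
    and "subring R S"
    and "regular_ring (S\<lparr>carrier := R\<rparr>)"
    and "projective_right_module TYPE('s \<Rightarrow> 's) TYPE('s)
           (S\<lparr>carrier := R\<rparr>) (right_module_of_ring S)"
    and "injective_left_module TYPE('s) TYPE('s) S E"
  shows "injective_left_module TYPE('m) TYPE('n) (S\<lparr>carrier := R\<rparr>) E"
proof -
  have E: "left_module S E"
    using assms(5) unfolding injective_left_module_def by blast
  \<comment> \<open>Baer's condition holds over \<open>S\<close> by injectivity, descends to
    \<open>R\<close>, and there implies injectivity for test modules of the arbitrary types
    \<open>'m\<close> and \<open>'n\<close>.\<close>
  show ?thesis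
    by (rule baer_criterion[OF left_module_restrict_scalars[OF E assms(2)]
          baer_restrict_scalars[OF E baer_of_injective[OF assms(5)] assms(2,4)]])
qed

end
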